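(* Let $f:\mathbb{H}\to\mathbb{H}$ be a slice regular function such that for every $\varepsilon>0$ one has $|f(q)|<e^{\varepsilon|q|}$ for all $q$ with $|q|$ sufficiently large (i.e. $f$ has order at most $1$ and type $0$). If for some $I\in\mathbb{S}$ the plane $L_I$ contains a (real) line on which $|f|$ is bounded, then $f$ is constant.
   Context: $\mathbb{H}$ denotes the quaternions with Euclidean norm $|q|$; $\mathbb{S}=\{ix_1+jx_2+kx_3: x_1^2+x_2^2+x_3^2=1\}$; for $I\in\mathbb{S}$, $L_I=\mathbb{R}+\mathbb{R}I$. A function $f:\mathbb{H}\to\mathbb{H}$ is slice regular if for every $I\in\mathbb{S}$ its restriction $f_I$ to $L_I$ satisfies $\frac12\left(\frac{\partial}{\partial x}+I\frac{\partial}{\partial y}\right)f_I(x+yI)=0$. *)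

theory Defs
  imports "HOL-Analysis.Analysis"
begin

text \<open>Quaternions modelled as R^4 = real * real * real * real, coordinates (a,b,c,d)
  standing for a + b i + c j + d k.  The product norm on this type is the Euclidean norm.\<close>

type_synonym quat = "real \<times> real \<times> real \<times> real"

fun qmult :: "quat \<Rightarrow> quat \<Rightarrow> quat" where
  "qmult (a1, b1, c1, d1) (a2, b2, c2, d2) =
     (a1*a2 - b1*b2 - c1*c2 - d1*d2,
      a1*b2 + b1*a2 + c1*d2 - d1*c2,
      a1*c2 - b1*d2 + c1*a2 + d1*b2,
      a1*d2 + b1*c2 - c1*b2 + d1*a2)"

definition qreal :: "real \<Rightarrow> quat" where
  "qreal x = (x, 0, 0, 0)"

definition imag_units :: "quat set" where
  "imag_units = {(0, x1, x2, x3) | x1 x2 x3. x1^2 + x2^2 + x3^2 = 1}"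

definition slice_pt :: "quat \<Rightarrow> real \<Rightarrow> real \<Rightarrow> quat" where
  "slice_pt I x y = qreal x + y *\<^sub>R I"

definition slice_regular :: "(quat \<Rightarrow> quat) \<Rightarrow> bool" where
  "slice_regular f \<longleftrightarrow>
     (\<forall>I\<in>imag_units. \<forall>x y. \<exists>D.
        ((\<lambda>p. f (slice_pt I (fst p) (snd p))) has_derivative D) (at (x, y)) \<and>
        (1/2) *\<^sub>R (D (1, 0) + qmult I (D (0, 1))) = 0)"

end

theory Submission
  imports Defs "HOL-Complex_Analysis.Complex_Analysis" "HOL-Real_Asymp.Real_Asymp"
begin

text \<open>
  Left multiplication by \<open>I\<close> turns the quaternions into a complex vector space, and slice
  regularity says that composing \<open>f\<close> on \<open>L\<^sub>I\<close> with any complex-linear functional gives an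
  entire function, of order at most 1 and type 0 by the growth assumption. By
  Phragmen--Lindeloef, such a function is bounded on both sides of a line on which it is
  bounded, so it is constant by Liouville. Hence \<open>f\<close> is constant on \<open>L\<^sub>I\<close>, in particular on
  the real axis, which lies in every slice; the identity theorem makes \<open>f\<close> constant on each
  of them.
\<close>

section \<open>Phragmen-Lindeloef in a quadrant\<close>

text \<open>If the square lies in the sector of half-angle pi/4 about the positive axis, then
  \<open>s\<close> lies in the one of half-angle pi/8 and its cube in the one of half-angle 3*pi/8 <
  pi/2, where the real part is comparable to the modulus.\<close>

lemma Re_cube_sqrt_ge:
  fixes s :: complex
  assumes "Re s \<ge> 0" "\<bar>Im (s\<^sup>2)\<bar> \<le> Re (s\<^sup>2)"
  shows "Re (s ^ 3) \<ge> norm s ^ 3 / 20"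
proof -
  define a b where "a = Re s" and "b = \<bar>Im s\<bar>"
  have a: "a \<ge> 0" "b \<ge> 0" using assms by (auto simp: a_def b_def)
  have sq: "(Im s)\<^sup>2 = b\<^sup>2" by (simp add: b_def)
  have "\<bar>Im (s\<^sup>2)\<bar> = 2 * a * b" using assms(1)
    by (simp add: a_def b_def abs_mult power2_eq_square)
  moreover have "Re (s\<^sup>2) = a\<^sup>2 - b\<^sup>2"
    by (simp add: a_def flip: sq) (simp add: power2_eq_square)
  ultimately have ab: "2 * a * b \<le> a\<^sup>2 - b\<^sup>2" using assms by simp
  \<comment> \<open>\<open>3/7\<close> is a rational number slightly above tan(pi/8) = sqrt 2 -
    1.\<close>
  have b: "b \<le> 3/7 * a"
  proof (rule ccontr)
    assume *: "\<not> b \<le> 3/7 * a"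
    hence "b\<^sup>2 \<ge> (3/7*a)\<^sup>2" "a * b \<ge> a * (3/7 * a)"
      using a by (intro power_mono mult_left_mono; simp)+
    hence "(a\<^sup>2) * (9/49 + 6/7) \<le> a\<^sup>2" using ab by (simp add: power2_eq_square algebra_simps)
    hence "a\<^sup>2 \<le> 0" by simp
    hence "a = 0" by simp
    with ab have "b = 0" by simp
    with * \<open>a = 0\<close> show False by simp
  qed
  have b2: "b\<^sup>2 \<le> a\<^sup>2 / 5"
  proof -
    have "b\<^sup>2 \<le> (3/7*a)\<^sup>2" using b a by (intro power_mono) auto
    also have "\<dots> \<le> a\<^sup>2/5" by (simp add: power_mult_distrib power_divide)
    finally show ?thesis .
  qed
  have "(norm s)\<^sup>2 = a\<^sup>2 + b\<^sup>2" by (simp add: cmod_power2 a_def sq)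
  also have "\<dots> \<le> (2*a)\<^sup>2"
    using b2 zero_le_power2[of a] unfolding power_mult_distrib power2_eq_square[of 2] by linarith
  finally have ns: "norm s \<le> 2 * a" by (rule power2_le_imp_le) (use a in simp)
  have "Re (s ^ 3) = a * (a\<^sup>2 - 3 * b\<^sup>2)"
    by (simp add: a_def power3_eq_cube flip: sq) (simp add: power2_eq_square algebra_simps)
  also have "\<dots> \<ge> a * (2/5 * a\<^sup>2)" using b2 a by (intro mult_left_mono) auto
  \<comment> \<open>With \<open>norm s \<le> 2 * a\<close>, the factor 2/5 becomes (2/5)/8 =
    1/20.\<close>
  finally have "Re (s^3) \<ge> 2/5 * a^3" by (simp add: power2_eq_square power3_eq_cube)
  moreover have "norm s ^ 3 \<le> (2*a)^3" using ns by (intro power_mono) auto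
  hence "norm s ^ 3 \<le> 8 * a^3" by (simp add: power_mult_distrib)
  ultimately show ?thesis by (simp add: field_simps)
qed

text \<open>Multiplication by \<open>1 - \<i>\<close> turns the quadrant onto the sector of
  half-angle pi/4 about the positive axis, and adding 1 stays inside it. The cube of the root is
  then the power 3/2, whose real part is controlled by \<open>Re_cube_sqrt_ge\<close>.\<close>

lemma quadrant_damping_bound:
  fixes z :: complex
  assumes "Re z \<ge> 0" "Im z \<ge> 0"
  shows "Re (csqrt (1 + (1 - \<i>) * z) ^ 3) \<ge> norm z * sqrt (norm z) / 20"
proof -
  define u where "u = 1 + (1 - \<i>) * z"
  have u: "Re u = 1 + Re z + Im z" "Im u = Im z - Re z" by (simp_all add: u_def)
  have "norm z \<le> \<bar>Re z\<bar> + \<bar>Im z\<bar>" by (rule cmod_le)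
  also have "\<dots> \<le> Re u" using assms by (simp add: u)
  also have "Re u \<le> norm u" by (rule complex_Re_le_cmod)
  finally have zu: "norm z \<le> norm u" .
  have "norm (csqrt u) ^ 3 / 20 \<le> Re (csqrt u ^ 3)"
    using assms by (intro Re_cube_sqrt_ge) (auto simp: csqrt_principal u Re_csqrt simp del: csqrt.simps)
  moreover have "norm z * sqrt (norm z) \<le> norm u * sqrt (norm u)"
    using zu by (intro mult_mono) auto
  moreover have "norm (csqrt u) ^ 3 = norm u * sqrt (norm u)"
  proof -
    have "(norm (csqrt u))\<^sup>2 = norm u" by (simp flip: norm_power)
    thus ?thesis by (metis norm_ge_zero power3_eq_cube power2_eq_square real_sqrt_unique)
  qed
  ultimately show ?thesis by (simp add: u_def)
qed

text \<open>
  The growth is of order 1, below the critical order 2 of the quadrant, so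
  damping of order 3/2 beats it. The base point is shifted by 1 to keep \<open>csqrt\<close> off its branch cut.
\<close>
lemma phragmen_lindelof_quadrant:
  fixes g :: "complex \<Rightarrow> complex"
  assumes hol: "g holomorphic_on UNIV"
    and growth: "\<And>z. norm (g z) \<le> C * exp (c * norm z)"
    and re: "\<And>x. x \<ge> 0 \<Longrightarrow> norm (g (of_real x)) \<le> K"
    and im: "\<And>y. y \<ge> 0 \<Longrightarrow> norm (g (\<i> * of_real y)) \<le> K"
    and K: "K > 0" and z: "Re z \<ge> 0" "Im z \<ge> 0"
  shows "norm (g z) \<le> K"
proof -
  define D where "D = (\<lambda>z. csqrt (1 + (1 - \<i>) * z) ^ 3)"
  have D: "Re (D w) \<ge> norm w * sqrt (norm w) / 20" if "Re w \<ge> 0" "Im w \<ge> 0" for w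
    using quadrant_damping_bound[OF that] by (simp add: D_def)
  have *: "norm (g z * exp (- of_real \<delta> * D z)) \<le> K" if \<delta>: "\<delta> > 0" for \<delta> :: real
  proof -
    define h where "h = (\<lambda>z. g z * exp (- of_real \<delta> * D z))"
    have "((\<lambda>r. C * exp (c * r) * exp (- \<delta> * (r * sqrt r / 20))) \<longlongrightarrow> 0) at_top"
    proof -
      have "((\<lambda>r. exp (r * (c - \<delta> * sqrt r / 20))) \<longlongrightarrow> 0) at_top"
        using \<delta> by real_asymp
      from tendsto_mult_right_zero[OF this, of C] show ?thesis
        by (simp add: algebra_simps flip: exp_add)
    qed
    hence "eventually (\<lambda>r. C * exp (c * r) * exp (- \<delta> * (r * sqrt r / 20)) < K) at_top"
      using K by (rule order_tendstoD)
    hence "eventually (\<lambda>r. C * exp (c * r) * exp (- \<delta> * (r * sqrt r / 20)) < K \<and> r \<ge> norm z) at_top"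
      using eventually_ge_at_top by (rule eventually_conj)
    \<comment> \<open>On the arc of radius \<open>r\<close> the damped function stays below
      \<open>K\<close>; the second condition puts \<open>z\<close> into the quarter disc
      \<open>S\<close>.\<close>
    then obtain r where r: "C * exp (c * r) * exp (- \<delta> * (r * sqrt r / 20)) < K" "r \<ge> norm z"
      by (auto simp: eventually_at_top_linorder)
    define S where "S = {w. Re w \<ge> 0 \<and> Im w \<ge> 0 \<and> norm w \<le> r}"
    have cl: "closed S" unfolding S_def
      by (intro closed_Collect_conj closed_Collect_le continuous_intros)
    have bd: "bounded S" by (rule boundedI[of _ r]) (auto simp: S_def)
    have nz: "1 + (1 - \<i>) * w \<notin> \<real>\<^sub>\<le>\<^sub>0" if "w \<in> S" for w
      using that by (auto simp: S_def complex_nonpos_Reals_iff)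
    have holh: "h holomorphic_on S" unfolding h_def D_def
      by (intro holomorphic_intros holomorphic_on_subset[OF hol]) (use nz in auto)
    have hle: "norm (h w) \<le> norm (g w) * exp (- \<delta> * (norm w * sqrt (norm w) / 20))" 
      if "Re w \<ge> 0" "Im w \<ge> 0" for w
      using D[OF that] \<delta> by (auto simp: h_def norm_mult intro!: mult_left_mono)
    have hle': "norm (h w) \<le> norm (g w)" if "Re w \<ge> 0" "Im w \<ge> 0" for w
    proof (rule order_trans[OF hle[OF that]])
      show "norm (g w) * exp (- \<delta> * (norm w * sqrt (norm w) / 20)) \<le> norm (g w)"
        using \<delta> by (intro mult_left_le) auto
    qed
    have fr: "norm (h w) \<le> K" if w: "w \<in> frontier S" for w
    proof -
      have wS: "w \<in> S" using w cl by (simp add: frontier_def closure_closed)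
      hence wp: "Re w \<ge> 0" "Im w \<ge> 0" by (auto simp: S_def)
      \<comment> \<open>The frontier lies on the two axes and the arc. On the axes the damping
        factor has modulus at most 1; on the arc the choice of \<open>r\<close> applies.\<close>
      have "Re w = 0 \<or> Im w = 0 \<or> norm w = r"
      proof (rule ccontr)
        assume "\<not> ?thesis"
        hence "w \<in> {w. 0 < Re w \<and> 0 < Im w \<and> norm w < r}" using wS by (auto simp: S_def)
        moreover have "open {w. 0 < Re w \<and> 0 < Im w \<and> norm w < r}"
          by (intro open_Collect_conj open_Collect_less continuous_intros)
        moreover have "{w. 0 < Re w \<and> 0 < Im w \<and> norm w < r} \<subseteq> S" by (auto simp: S_def)
        ultimately have "w \<in> interior S" by (meson interiorI)
        thus False using w by (simp add: frontier_def)
      qed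
      then consider "Re w = 0" | "Im w = 0" | "norm w = r" by blast
      thus ?thesis
      proof cases
        case 1
        hence "w = \<i> * of_real (Im w)" by (simp add: complex_eq_iff)
        thus ?thesis using hle'[OF wp] im[OF wp(2)] by simp
      next
        case 2
        hence "w = of_real (Re w)" by (simp add: complex_eq_iff)
        thus ?thesis using hle'[OF wp] re[OF wp(1)] by simp
      next
        case 3
        have "norm (h w) \<le> norm (g w) * exp (- \<delta> * (r * sqrt r / 20))" using hle[OF wp] 3 by simp
        also have "\<dots> \<le> C * exp (c * r) * exp (- \<delta> * (r * sqrt r / 20))"
          using growth[of w] 3 by (intro mult_right_mono) auto
        finally show ?thesis using r by simp
      qed
    qed
    have "norm (h z) \<le> K"
    proof (rule maximum_modulus_frontier[OF _ _ bd fr])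
      show "h holomorphic_on interior S" using holh interior_subset holomorphic_on_subset by blast
      show "continuous_on (closure S) h" using holh cl by (simp add: holomorphic_on_imp_continuous_on)
      show "z \<in> S" using z r by (auto simp: S_def)
    qed
    thus ?thesis by (simp add: h_def)
  qed
  \<comment> \<open>The bound \<open>K\<close> does not depend on \<delta>, so the damping can be
    removed by letting \<delta> tend to 0.\<close>
  have "((\<lambda>\<delta>. norm (g z * exp (- of_real \<delta> * D z))) \<longlongrightarrow> norm (g z * exp (- of_real 0 * D z))) (at_right 0)"
    by (intro tendsto_intros)
  moreover have "eventually (\<lambda>\<delta>. norm (g z * exp (- of_real \<delta> * D z)) \<le> K) (at_right (0::real))"
    by (rule eventually_at_rightI[of 0 1]) (use * in auto)
  ultimately have "norm (g z * exp (- of_real 0 * D z)) \<le> K"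
    by (rule tendsto_upperbound) simp
  thus ?thesis by simp
qed

section \<open>Functions of type zero on half-planes and along lines\<close>

text \<open>
  A half-plane has critical order 1. The factor \<open>exp (\<i>ez)\<close> makes \<open>F\<close> decay along the
  imaginary axis, so the two quadrants give a bound on the half-plane. If it exceeded \<open>M\<close>,
  it would be attained at an interior point of that axis, against the maximum principle.
\<close>
lemma type_zero_bounded_upper_halfplane:
  fixes F :: "complex \<Rightarrow> complex"
  assumes hol: "F holomorphic_on UNIV"
    and growth: "\<And>e. e > 0 \<Longrightarrow> \<exists>C. \<forall>z. norm (F z) \<le> C * exp (e * norm z)"
    and re: "\<And>x. norm (F (of_real x)) \<le> M" and M: "M > 0" and z: "Im z \<ge> 0"
  shows "norm (F z) \<le> M"
proof -
  have *: "norm (F z * exp (\<i> * of_real e * z)) \<le> M" if e: "e > 0" for e :: real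
  proof -
    define g where "g = (\<lambda>z. F z * exp (\<i> * of_real e * z))"
    have ng: "norm (g w) = norm (F w) * exp (- e * Im w)" for w
      by (simp add: g_def norm_mult)
    have holg: "g holomorphic_on UNIV" unfolding g_def by (intro holomorphic_intros hol)
    \<comment> \<open>Type \<open>e/2\<close> is half the decay rate of the exponential factor,
      which leaves decay like exp(-e*y/2) on the positive imaginary axis.\<close>
    obtain C where C: "\<And>z. norm (F z) \<le> C * exp (e/2 * norm z)"
      using growth[of "e/2"] e by auto
    \<comment> \<open>Any finite type suffices in the quadrant; \<open>2 * e\<close> rounds up
      \<open>e/2 + e\<close>.\<close>
    have gg: "norm (g w) \<le> C * exp (2 * e * norm w)" for w
    proof -
      have "C * exp (e/2 * norm w) \<ge> 0" by (rule order_trans[OF norm_ge_zero C])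
      moreover have "- e * Im w \<le> e * norm w"
        using e abs_Im_le_cmod[of w] mult_left_mono[of "- Im w" "norm w" e] by simp
      ultimately have "norm (g w) \<le> C * exp (e/2 * norm w) * exp (e * norm w)"
        unfolding ng using C[of w] by (intro mult_mono) auto
      also have "\<dots> = C * exp (3/2 * e * norm w)" by (simp add: field_simps flip: exp_add)
      also have "\<dots> \<le> C * exp (2 * e * norm w)"
        using e \<open>C * exp (e/2 * norm w) \<ge> 0\<close> by (intro mult_left_mono) (auto simp: zero_le_mult_iff)
      finally show ?thesis .
    qed
    have gre: "norm (g (of_real x)) \<le> M" for x using re[of x] by (simp add: ng)
    have gim: "norm (g (\<i> * of_real y)) \<le> C * exp (- e/2 * y)" if "y \<ge> 0" for y
    proof -
      have "norm (g (\<i> * of_real y)) \<le> C * exp (e/2 * y) * exp (- e * y)"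
        unfolding ng using C[of "\<i> * of_real y"] that by (auto simp: norm_mult)
      also have "\<dots> = C * exp (- e/2 * y)" by (simp add: field_simps flip: exp_add)
      finally show ?thesis .
    qed
    have "((\<lambda>y. C * exp (- e/2 * y)) \<longlongrightarrow> 0) at_top" using e by real_asymp
    hence "eventually (\<lambda>y. C * exp (- e/2 * y) < M) at_top" using M by (rule order_tendstoD)
    then obtain Y0 where Y0: "\<And>y. y \<ge> Y0 \<Longrightarrow> C * exp (- e/2 * y) < M"
      by (auto simp: eventually_at_top_linorder)
    \<comment> \<open>The maximum with 1 makes \<open>Y\<close> positive, so that \<i>Y lies in the
      open half-plane.\<close>
    define Y where "Y = max Y0 1"
    have Y: "norm (g (\<i> * of_real y)) < M" if "y \<ge> Y" for y
      using gim[of y] Y0[of y] that by (auto simp: Y_def)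
    have contg: "continuous_on UNIV g" using holg by (rule holomorphic_on_imp_continuous_on)
    have "continuous_on {0..Y} (\<lambda>y. norm (g (\<i> * of_real y)))"
      by (intro continuous_intros continuous_on_compose2[OF contg]) auto
    moreover have "{0..Y} \<noteq> {}" by (simp add: Y_def le_max_iff_disj)
    ultimately obtain y0 where y0: "y0 \<in> {0..Y}"
      and max: "\<And>y. y \<in> {0..Y} \<Longrightarrow> norm (g (\<i> * of_real y)) \<le> norm (g (\<i> * of_real y0))"
      using continuous_attains_sup[OF compact_Icc] by meson
    define N where "N = max M (norm (g (\<i> * of_real y0)))"
    have N: "norm (g (\<i> * of_real y)) \<le> N" if "y \<ge> 0" for y
      using max[of y] Y[of y] that by (cases "y \<le> Y") (auto simp: N_def)
    have "N > 0" using M by (simp add: N_def)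
    have up: "norm (g w) \<le> N" if w: "Im w \<ge> 0" for w
    proof (cases "Re w \<ge> 0")
      case True
      show ?thesis
        by (rule phragmen_lindelof_quadrant[OF holg gg _ N \<open>N > 0\<close> True w])
           (use gre in \<open>auto simp: N_def le_max_iff_disj\<close>)
    next
      case False
      \<comment> \<open>Rotation by \<i> carries the first quadrant to the second: its real edge
        goes to the imaginary axis, its imaginary edge to the negative real axis.\<close>
      have "norm (g (\<i> * (- \<i> * w))) \<le> N"
      proof (rule phragmen_lindelof_quadrant[where g = "\<lambda>z. g (\<i> * z)", OF _ _ _ _ \<open>N > 0\<close>])
        show "(\<lambda>z. g (\<i> * z)) holomorphic_on UNIV"
          by (rule holomorphic_on_compose_gen[OF _ holg, unfolded o_def]) (auto intro!: holomorphic_intros)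
        show "norm (g (\<i> * z)) \<le> C * exp (2 * e * norm z)" for z
          using gg[of "\<i> * z"] by (simp add: norm_mult)
        show "norm (g (\<i> * of_real x)) \<le> N" if "x \<ge> 0" for x using N that .
        show "norm (g (\<i> * (\<i> * of_real x))) \<le> N" for x
          using gre[of "-x"] by (simp add: N_def flip: mult.assoc)
      qed (use w False in auto)
      thus ?thesis by (simp flip: mult.assoc)
    qed
    have "N \<le> M"
    proof (rule ccontr)
      assume "\<not> N \<le> M"
      hence N0: "N = norm (g (\<i> * of_real y0))" "N > M" by (auto simp: N_def)
      have "y0 \<noteq> 0" using N0 gre[of 0] by auto
      hence "y0 > 0" using y0 by auto
      have "g constant_on {w. Im w > 0}"
      proof (rule maximum_modulus_principle)
        show "g holomorphic_on {w. Im w > 0}" using holg holomorphic_on_subset by blast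
        show "open {w. Im w > 0}" by (rule open_halfspace_Im_gt)
        thus "open {w. Im w > 0}" .
        show "connected {w. Im w > 0}" by (intro convex_connected convex_halfspace_Im_gt)
        show "\<i> * of_real y0 \<in> {w. Im w > 0}" using \<open>y0 > 0\<close> by simp
        show "norm (g w) \<le> norm (g (\<i> * of_real y0))" if "w \<in> {w. Im w > 0}" for w
          using up[of w] that N0 by auto
      qed auto
      \<comment> \<open>A constant of modulus \<open>N > M\<close> is incompatible with the decay
        already reached at \<i>Y.\<close>
      hence "g (\<i> * of_real y0) = g (\<i> * of_real Y)"
        using \<open>y0 > 0\<close> by (auto simp: constant_on_def Y_def)
      with N0 Y[of Y] show False by simp
    qed
    with up[OF z] show ?thesis by (simp add: g_def)
  qed
  have "((\<lambda>e. norm (F z * exp (\<i> * of_real e * z))) \<longlongrightarrow> norm (F z * exp (\<i> * of_real 0 * z))) (at_right 0)"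
    by (intro tendsto_intros)
  moreover have "eventually (\<lambda>e. norm (F z * exp (\<i> * of_real e * z)) \<le> M) (at_right (0::real))"
    by (rule eventually_at_rightI[of 0 1]) (use * in auto)
  ultimately have "norm (F z * exp (\<i> * of_real 0 * z)) \<le> M"
    by (rule tendsto_upperbound) simp
  thus ?thesis by simp
qed

text \<open>The substitution of -z for z carries the half-plane bound to the lower half-plane; a
  bounded entire function is constant.\<close>

lemma type_zero_bounded_real_imp_constant:
  fixes F :: "complex \<Rightarrow> complex"
  assumes hol: "F holomorphic_on UNIV"
    and growth: "\<And>e. e > 0 \<Longrightarrow> \<exists>C. \<forall>z. norm (F z) \<le> C * exp (e * norm z)"
    and re: "\<And>x. norm (F (of_real x)) \<le> M"
  shows "F constant_on UNIV"
proof (rule Liouville_theorem[OF hol])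
  \<comment> \<open>The half-plane bound asks for a positive constant.\<close>
  have re': "norm (F (of_real x)) \<le> max M 1" for x using re[of x] by simp
  have "norm (F z) \<le> max M 1" for z
  proof (cases "Im z \<ge> 0")
    case True
    thus ?thesis by (intro type_zero_bounded_upper_halfplane[OF hol growth re']) auto
  next
    case False
    have "norm (F (- (- z))) \<le> max M 1"
    proof (rule type_zero_bounded_upper_halfplane[where F = "\<lambda>z. F (- z)"])
      show "(\<lambda>z. F (- z)) holomorphic_on UNIV"
        by (rule holomorphic_on_compose_gen[OF _ hol, unfolded o_def]) (auto intro!: holomorphic_intros)
      show "\<exists>C. \<forall>z. norm (F (- z)) \<le> C * exp (e * norm z)" if "e > 0" for e
        using growth[OF that] by (metis norm_minus_cancel)
      show "norm (F (- of_real x)) \<le> max M 1" for x using re'[of "-x"] by simp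
    qed (use False in auto)
    thus ?thesis by simp
  qed
  thus "bounded (range F)" by (auto simp: bounded_iff)
qed

text \<open>An affine substitution moves the line to the real axis. It multiplies the type by at
  most \<open>norm v\<close>, so type zero is preserved.\<close>

lemma type_zero_bounded_line_imp_constant:
  fixes F :: "complex \<Rightarrow> complex"
  assumes hol: "F holomorphic_on UNIV"
    and growth: "\<And>e. e > 0 \<Longrightarrow> \<exists>C. \<forall>z. norm (F z) \<le> C * exp (e * norm z)"
    and v: "v \<noteq> 0" and line: "\<And>t. norm (F (a + of_real t * v)) \<le> M"
  shows "F constant_on UNIV"
proof -
  have "(\<lambda>z. F (a + z * v)) constant_on UNIV"
  proof (rule type_zero_bounded_real_imp_constant[where M = M])
    show "norm (F (a + of_real x * v)) \<le> M" for x by (rule line)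
    show "(\<lambda>z. F (a + z * v)) holomorphic_on UNIV"
      by (rule holomorphic_on_compose_gen[OF _ hol, unfolded o_def]) (auto intro!: holomorphic_intros)
    fix e :: real assume e: "e > 0"
    define e' where "e' = e / norm v"
    have "e' > 0" using e v by (simp add: e'_def)
    then obtain C where C: "\<And>z. norm (F z) \<le> C * exp (e' * norm z)" using growth by blast
    have C0: "C \<ge> 0" using order_trans[OF norm_ge_zero C[of 0]] by simp
    have "norm (F (a + z * v)) \<le> (C * exp (e' * norm a)) * exp (e * norm z)" for z
    proof -
      have "norm (F (a + z * v)) \<le> C * exp (e' * norm (a + z * v))" by (rule C)
      also have "\<dots> \<le> C * exp (e' * (norm a + norm z * norm v))"
        using C0 \<open>e' > 0\<close> norm_triangle_ineq[of a "z * v"]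
        by (intro mult_left_mono) (auto simp: norm_mult)
      also have "\<dots> = (C * exp (e' * norm a)) * exp (e * norm z)"
        using v by (simp add: e'_def ring_distribs exp_add)
      finally show ?thesis .
    qed
    thus "\<exists>C. \<forall>z. norm (F (a + z * v)) \<le> C * exp (e * norm z)" by blast
  qed
  then obtain c where c: "\<And>z. F (a + z * v) = c" by (auto simp: constant_on_def)
  have "F w = c" for w using c[of "(w - a) / v"] v by simp
  thus ?thesis by (auto simp: constant_on_def)
qed

section \<open>Complex-linear functionals and slices\<close>

text \<open>
  Left multiplication by \<open>I\<close> is a complex structure on the quaternions; this is the
  complex-linear functional whose real part is the inner product with \<open>w\<close>.
\<close>
definition slice_functional :: "quat \<Rightarrow> quat \<Rightarrow> quat \<Rightarrow> complex" where
  "slice_functional I w q = Complex (q \<bullet> w) (- (qmult I q \<bullet> w))"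

lemma qmult_imag_unit_twice:
  assumes "I \<in> imag_units"
  shows "qmult I (qmult I q) = - q"
proof -
  obtain x y z where I: "I = (0, x, y, z)" and "x\<^sup>2 + y\<^sup>2 + z\<^sup>2 = 1"
    using assms by (auto simp: imag_units_def)
  hence x: "x * x = 1 - y * y - z * z" by (simp add: power2_eq_square)
  obtain a b c d where q: "q = (a, b, c, d)" by (metis prod.exhaust)
  \<comment> \<open>The relation for \<open>x * x\<close> is restated for the right-nested products
    that \<open>algebra_simps\<close> produces.\<close>
  have "x * (x * t) = t - y * (y * t) - z * (z * t)" for t
    using arg_cong[OF x, of "\<lambda>s. s * t"] by (simp add: algebra_simps)
  thus ?thesis by (simp add: I q algebra_simps)
qed

lemma qmult_minus_right: "qmult p (- q) = - qmult p q"
  by (cases p; cases q) (auto simp: algebra_simps)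

lemma slice_functional_bounded_linear: "bounded_linear (slice_functional I w)"
proof -
  obtain a b c d where I: "I = (a, b, c, d)" by (metis prod.exhaust)
  have "linear (slice_functional I w)"
  proof
    show "slice_functional I w (p + q) = slice_functional I w p + slice_functional I w q" for p q
      by (cases p; cases q; cases w) (simp add: slice_functional_def I complex_eq_iff algebra_simps inner_prod_def)
    show "slice_functional I w (r *\<^sub>R p) = r *\<^sub>R slice_functional I w p" for r p
      by (cases p; cases w) (simp add: slice_functional_def I complex_eq_iff algebra_simps inner_prod_def)
  qed
  thus ?thesis by (rule linear_conv_bounded_linear[THEN iffD1])
qed

text \<open>Since \<open>I\<close> squares to -1, multiplying by it swaps the two components up to
  the sign that \<i> produces.\<close>

lemma slice_functional_qmult:
  assumes "I \<in> imag_units"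
  shows "slice_functional I w (qmult I q) = \<i> * slice_functional I w q"
  by (simp add: slice_functional_def qmult_imag_unit_twice[OF assms] complex_eq_iff)

text \<open>1 and \<open>I\<close> are orthonormal; this lets growth in the quaternion norm be read
  as growth in the complex variable.\<close>

lemma norm_slice_pt:
  assumes "I \<in> imag_units"
  shows "norm (slice_pt I (Re z) (Im z)) = norm z"
proof -
  obtain a b c where I: "I = (0, a, b, c)" and "a\<^sup>2 + b\<^sup>2 + c\<^sup>2 = 1"
    using assms by (auto simp: imag_units_def)
  hence "(Im z * a)\<^sup>2 + ((Im z * b)\<^sup>2 + (Im z * c)\<^sup>2) = (Im z)\<^sup>2"
    by (simp add: power_mult_distrib flip: distrib_left add.assoc)
  thus ?thesis by (simp add: slice_pt_def qreal_def I norm_prod_def cmod_def)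
qed

text \<open>The functional turns multiplication by \<open>I\<close> into multiplication by \<i>, so
  slice regularity becomes the Cauchy-Riemann equation.\<close>

lemma slice_functional_holomorphic:
  assumes reg: "slice_regular f" and I: "I \<in> imag_units"
  shows "(\<lambda>z. slice_functional I w (f (slice_pt I (Re z) (Im z)))) holomorphic_on UNIV"
proof -
  let ?L = "slice_functional I w"
  interpret L: bounded_linear ?L by (rule slice_functional_bounded_linear)
  have "\<exists>d. ((\<lambda>z. ?L (f (slice_pt I (Re z) (Im z)))) has_field_derivative d) (at z)" for z
  proof -
    obtain D where D: "((\<lambda>p. f (slice_pt I (fst p) (snd p))) has_derivative D) (at (Re z, Im z))"
      and CR: "(1/2) *\<^sub>R (D (1, 0) + qmult I (D (0, 1))) = 0"
      using reg I unfolding slice_regular_def by blast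
    interpret D: bounded_linear D using D by (rule has_derivative_bounded_linear)
    \<comment> \<open>Multiplying by \<open>I\<close> solves the equation for the
      y-derivative.\<close>
    from CR have "D (1, 0) = - qmult I (D (0, 1))" by (simp add: eq_neg_iff_add_eq_0)
    hence "D (0, 1) = qmult I (D (1, 0))"
      by (simp add: qmult_imag_unit_twice[OF I] qmult_minus_right)
    hence LD: "?L (D (0, 1)) = \<i> * ?L (D (1, 0))" by (simp add: slice_functional_qmult[OF I])
    have "((\<lambda>z. (Re z, Im z)) has_derivative (\<lambda>h. (Re h, Im h))) (at z)"
      by (intro derivative_intros bounded_linear_imp_has_derivative bounded_linear_Re bounded_linear_Im)
    from has_derivative_compose[OF this, of "\<lambda>p. f (slice_pt I (fst p) (snd p))" D] D
    have "((\<lambda>z. f (slice_pt I (Re z) (Im z))) has_derivative (\<lambda>h. D (Re h, Im h))) (at z)"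
      by simp
    hence "((\<lambda>z. ?L (f (slice_pt I (Re z) (Im z)))) has_derivative (\<lambda>h. ?L (D (Re h, Im h)))) (at z)"
      by (rule L.has_derivative)
    moreover have "?L (D (Re h, Im h)) = ?L (D (1, 0)) * h" for h
    proof -
      have "(Re h, Im h) = Re h *\<^sub>R (1, 0) + Im h *\<^sub>R (0, 1)" by simp
      hence "D (Re h, Im h) = Re h *\<^sub>R D (1, 0) + Im h *\<^sub>R D (0, 1)"
        by (simp only: D.add D.scaleR)
      hence "?L (D (Re h, Im h)) = Re h *\<^sub>R ?L (D (1, 0)) + Im h *\<^sub>R (\<i> * ?L (D (1, 0)))"
        by (simp only: L.add L.scaleR LD)
      also have "\<dots> = ?L (D (1, 0)) * h" by (simp add: complex_eq_iff algebra_simps)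
      finally show ?thesis .
    qed
    ultimately have "((\<lambda>z. ?L (f (slice_pt I (Re z) (Im z)))) has_field_derivative ?L (D (1, 0))) (at z)"
      by (simp add: has_field_derivative_def)
    thus ?thesis by blast
  qed
  thus ?thesis by (simp add: holomorphic_on_def field_differentiable_def)
qed

text \<open>Testing with \<open>w\<close> equal to the difference of the two values, the real part
  of the functional gives \<open>w \<bullet> w = 0\<close>. The reference point 0 is common to all
  slices.\<close>

lemma slice_functionals_constant_imp_constant:
  assumes "\<And>w. (\<lambda>z. slice_functional I w (f (slice_pt I (Re z) (Im z)))) constant_on UNIV"
  shows "f (slice_pt I x y) = f (qreal 0)"
proof -
  define w where "w = f (slice_pt I x y) - f (qreal 0)"
  have "slice_functional I w (f (slice_pt I (Re (Complex x y)) (Im (Complex x y)))) =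
        slice_functional I w (f (slice_pt I (Re 0) (Im 0)))"
    using assms[of w] unfolding constant_on_def by (metis UNIV_I)
  hence "f (slice_pt I x y) \<bullet> w = f (qreal 0) \<bullet> w"
    by (simp add: slice_functional_def slice_pt_def)
  hence "w \<bullet> w = 0" by (simp add: w_def inner_diff_left)
  thus ?thesis by (simp add: w_def)
qed

text \<open>Normalising the imaginary part yields the unit; for a real quaternion any unit will
  do.\<close>

lemma quat_in_slice: "\<exists>I\<in>imag_units. \<exists>x y. q = slice_pt I x y"
proof -
  obtain a b c d where q: "q = (a, b, c, d)" by (metis prod.exhaust)
  define r where "r = sqrt (b\<^sup>2 + c\<^sup>2 + d\<^sup>2)"
  show ?thesis
  proof (cases "r = 0")
    case True
    hence "b\<^sup>2 + c\<^sup>2 + d\<^sup>2 = 0" by (simp add: r_def)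
    hence "b = 0 \<and> c = 0 \<and> d = 0"
      by (metis add_nonneg_eq_0_iff add_nonneg_nonneg zero_le_power2 power_eq_0_iff)
    hence "q = slice_pt (0, 1, 0, 0) a 0" by (simp add: q slice_pt_def qreal_def)
    moreover have "(0, 1, 0, 0) \<in> imag_units" by (simp add: imag_units_def)
    ultimately show ?thesis by blast
  next
    case False
    have "r\<^sup>2 = b\<^sup>2 + c\<^sup>2 + d\<^sup>2" by (simp add: r_def)
    hence "(b/r)\<^sup>2 + (c/r)\<^sup>2 + (d/r)\<^sup>2 = 1" using False
      by (metis add_divide_distrib divide_self power_divide power_not_zero)
    hence "(0, b/r, c/r, d/r) \<in> imag_units" by (simp add: imag_units_def)
    moreover have "q = slice_pt (0, b/r, c/r, d/r) a r" 
      using False by (simp add: q slice_pt_def qreal_def)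
    ultimately show ?thesis by blast
  qed
qed

section \<open>From one slice to the real axis and to every slice\<close>

theorem theorem4p9:
  fixes f :: "quat \<Rightarrow> quat"
  assumes reg: "slice_regular f"
    and growth: "\<forall>\<epsilon>>0. \<exists>R. \<forall>q. norm q \<ge> R \<longrightarrow> norm (f q) < exp (\<epsilon> * norm q)"
    and line: "\<exists>I\<in>imag_units. \<exists>a1 a2 v1 v2 M. (v1, v2) \<noteq> (0, 0) \<and>
                 (\<forall>t::real. norm (f (slice_pt I (a1 + t * v1) (a2 + t * v2))) \<le> M)"
  shows "\<exists>c. \<forall>q. f q = c"
proof -
  obtain I a1 a2 v1 v2 M where I: "I \<in> imag_units" and v: "(v1, v2) \<noteq> (0, 0)"
    and M: "\<And>t::real. norm (f (slice_pt I (a1 + t * v1) (a2 + t * v2))) \<le> M"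
    using line by blast
  have "(\<lambda>z. slice_functional I w (f (slice_pt I (Re z) (Im z)))) constant_on UNIV" for w
  proof -
    let ?F = "\<lambda>z. slice_functional I w (f (slice_pt I (Re z) (Im z)))"
    obtain B where B: "B > 0" "\<And>q. norm (slice_functional I w q) \<le> norm q * B"
      using bounded_linear.pos_bounded[OF slice_functional_bounded_linear] by blast
    have hol: "?F holomorphic_on UNIV" using reg I by (rule slice_functional_holomorphic)
    show ?thesis
    proof (rule type_zero_bounded_line_imp_constant[OF hol])
      show "Complex v1 v2 \<noteq> 0" using v by (simp add: complex_eq_iff)
      show "norm (?F (Complex a1 a2 + of_real t * Complex v1 v2)) \<le> M * B" for t
      proof -
        have "norm (?F (Complex a1 a2 + of_real t * Complex v1 v2))
              \<le> norm (f (slice_pt I (a1 + t * v1) (a2 + t * v2))) * B"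
          using B(2)[of "f (slice_pt I (a1 + t * v1) (a2 + t * v2))"] by simp
        also have "\<dots> \<le> M * B" using M[of t] B(1) by (intro mult_right_mono) auto
        finally show ?thesis .
      qed
      fix e :: real assume e: "e > 0"
      \<comment> \<open>The growth assumption controls only large arguments; compactness handles the
        disc of radius \<open>R\<close>, and \<open>max K B\<close> serves both regions.\<close>
      obtain R where R: "\<And>q. norm q \<ge> R \<Longrightarrow> norm (f q) < exp (e * norm q)"
        using growth e by blast
      have "compact (?F ` cball 0 R)"
        by (intro compact_continuous_image compact_cball continuous_on_subset
              [OF holomorphic_on_imp_continuous_on[OF hol]]) auto
      then obtain K where "\<forall>u\<in>?F ` cball 0 R. norm u \<le> K"
        using compact_imp_bounded bounded_iff by meson
      hence K: "norm (?F z) \<le> K" if "norm z \<le> R" for z using that by simp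
      have "norm (?F z) \<le> max K B * exp (e * norm z)" for z
      proof (cases "norm z \<le> R")
        case True
        have "norm (?F z) \<le> max K B * 1" using K[OF True] by simp
        also have "\<dots> \<le> max K B * exp (e * norm z)"
          using B(1) e by (intro mult_left_mono) auto
        finally show ?thesis .
      next
        case False
        let ?q = "slice_pt I (Re z) (Im z)"
        have "norm (?F z) \<le> norm (f ?q) * B" by (rule B(2))
        also have "\<dots> \<le> exp (e * norm z) * max K B"
          using R[of ?q] False B(1) by (intro mult_mono) (auto simp: norm_slice_pt[OF I])
        finally show ?thesis by (simp add: mult.commute)
      qed
      thus "\<exists>C. \<forall>z. norm (?F z) \<le> C * exp (e * norm z)" by blast
    qed
  qed
  \<comment> \<open>Taking \<open>y = 0\<close> keeps only the real axis, where the value no longer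
    refers to \<open>I\<close>.\<close>
  hence "f (slice_pt I x 0) = f (qreal 0)" for x by (rule slice_functionals_constant_imp_constant)
  hence real: "f (qreal x) = f (qreal 0)" for x by (simp add: slice_pt_def)
  have "f q = f (qreal 0)" for q
  proof -
    obtain J x y where J: "J \<in> imag_units" and q: "q = slice_pt J x y" using quat_in_slice by blast
    have "(\<lambda>z. slice_functional J w (f (slice_pt J (Re z) (Im z)))) constant_on UNIV" for w
    \<comment> \<open>The identity theorem applies on the slice of \<open>J\<close> because the real
      axis accumulates at 0.\<close>
    proof (rule analytic_continuation'[OF slice_functional_holomorphic[OF reg J]])
      show "(0::complex) islimpt \<real>"
      proof (rule islimptI)
        fix T :: "complex set" assume "0 \<in> T" "open T"
        then obtain d where d: "d > 0" "ball 0 d \<subseteq> T" by (meson openE)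
        hence "complex_of_real (d/2) \<in> T" by (intro subsetD[OF d(2)]) auto
        thus "\<exists>y\<in>\<real>. y \<in> T \<and> y \<noteq> 0" using d(1)
          by (intro bexI[of _ "complex_of_real (d/2)"]) auto
      qed
      show "(\<lambda>z. slice_functional J w (f (slice_pt J (Re z) (Im z)))) constant_on \<real>"
      proof -
        have "f (slice_pt J (Re z) (Im z)) = f (qreal 0)" if "z \<in> \<real>" for z
          using that real[of "Re z"] by (simp add: complex_is_Real_iff slice_pt_def)
        thus ?thesis by (auto simp: constant_on_def)
      qed
    qed auto
    thus ?thesis unfolding q by (rule slice_functionals_constant_imp_constant)
  qed
  thus ?thesis by blast
qed

end
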